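(* Let $G$ be a finite graph satisfying the standing assumptions of the context, let $W$ denote the set of those vertices $i\in V(G)$ such that $G$ has no loop at $i$, and let $G'$ be the induced subgraph of $G$ on $W$. Assume that $W\neq\emptyset$ and that $G$ is of one of the types ($\alpha$), ($\beta$), ($\gamma$) below. Then the Ehrhart polynomial $i(\mathcal{P}_G,m)$ and the normalized volume ${\rm vol}(\mathcal{P}_G)$ of the edge polytope $\mathcal{P}_G$ are as follows. ($\alpha$) If $G$ is a complete bipartite graph with at least one cycle of length $4$, on the vertex set $V_1\cup V_2$ with $|V_1|=p$ and $|V_2|=q$, then $$i(\mathcal{P}_G,m)=\binom{p+m-1}{p-1}\binom{q+m-1}{q-1},\qquad {\rm vol}(\mathcal{P}_G)=\binom{p+q-2}{p-1}.$$ ($\beta$) If $G$ has exactly one loop, the vertex carrying the loop is joined by an edge to every $j\in W$, and $G'$ is the complete bipartite graph on the vertex set $V_1\cup V_2$ with $|V_1|=p$ and $|V_2|=q$, then $$i(\mathcal{P}_G,m)=\binom{p+m}{p}\binom{q+m}{q},\qquad {\rm vol}(\mathcal{P}_G)=\binom{p+q}{p}.$$ ($\gamma$) If $G$ has exactly $p\geq 2$ loops, $G'$ has no edge, every vertex carrying a loop is joined by an edge to every $j\in W$, and $|V(G)|=d$, then $$i(\mathcal{P}_G,m)=\sum_{j=1}^{p}\binom{j+m-2}{j-1}\binom{d-j+m}{d-j},\qquad {\rm vol}(\mathcal{P}_G)=\sum_{j=1}^{p}\binom{d-1}{j-1}.$$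
   Context: Standing assumptions: $G$ is a finite graph on the vertex set $V(G)=\{1,\dots,d\}$, allowing loops, having no multiple edge and no isolated vertex (a vertex carrying a loop is not isolated); $E(G)$ is its set of edges and loops, a loop at $i$ being written $\{i,i\}$. Moreover $G$ satisfies condition $( * )$: if $G$ has a loop at each of $i$ and $j$, then $\{i,j\}\in E(G)$. Edge polytope: for $e=\{i,j\}\in E(G)$ put $\rho(e)=\mathbf{e}_i+\mathbf{e}_j\in\mathbb{R}^d$ (so $\rho(\{i,i\})=2\mathbf{e}_i$); $\mathcal{P}_G$ is the convex hull of $\{\rho(e): e\in E(G)\}$. The induced subgraph on $U\subset V(G)$ has vertex set $U$ and as edges all $\{i,j\}\in E(G)$ (loops included) with $i,j\in U$. Complete bipartite graphs have both parts nonempty and have no loops. For an integral convex polytope $\mathcal{P}\subset\mathbb{R}^d$, the Ehrhart polynomial is the polynomial $i(\mathcal{P},m)$ in $m$, of degree $\dim\mathcal{P}$, with $i(\mathcal{P},m)=|m\mathcal{P}\cap\mathbb{Z}^d|$ for all integers $m\geq 1$. The normalized volume is ${\rm vol}(\mathcal{P})=(\dim\mathcal{P})!$ times the leading coefficient of $i(\mathcal{P},m)$. *)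

theory Defs
  imports "HOL-Analysis.Analysis" "HOL-Computational_Algebra.Polynomial"
begin

text \<open>
  A finite graph with loops and without multiple edges, whose vertex set is the finite
  type \<open>'n\<close>, is given by its set \<open>E\<close> of edges and loops. The loop at \<open>i\<close> is
  the (one-element) set \<open>{i, i}\<close>; the vectors of \<open>\<real>\<^sup>d\<close> are those of type
  \<open>real ^ 'n\<close>, with \<open>d = CARD('n)\<close>.
\<close>

definition loop_graph :: "'n set set \<Rightarrow> bool" where
  "loop_graph E \<longleftrightarrow> (\<forall>e\<in>E. \<exists>i j. e = {i, j})"

definition has_loop :: "'n set set \<Rightarrow> 'n \<Rightarrow> bool" where
  "has_loop E i \<longleftrightarrow> {i, i} \<in> E"

text \<open>The case \<open>j = i\<close> is allowed: a vertex carrying a loop is not isolated.\<close>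

definition no_isolated_vertex :: "'n set set \<Rightarrow> bool" where
  "no_isolated_vertex E \<longleftrightarrow> (\<forall>i. \<exists>j. {i, j} \<in> E)"

definition loops_adjacent :: "'n set set \<Rightarrow> bool" where
  "loops_adjacent E \<longleftrightarrow> (\<forall>i j. has_loop E i \<and> has_loop E j \<longrightarrow> {i, j} \<in> E)"

definition induced_edges :: "'n set set \<Rightarrow> 'n set \<Rightarrow> 'n set set" where
  "induced_edges E U = {e \<in> E. e \<subseteq> U}"

text \<open>The graph with vertex set \<open>U\<close> and edge set \<open>F\<close> is complete bipartite with
  parts \<open>V\<^sub>1\<close> and \<open>V\<^sub>2\<close>; disjointness of the parts excludes loops.\<close>

definition complete_bipartite_on ::
    "'n set \<Rightarrow> 'n set set \<Rightarrow> 'n set \<Rightarrow> 'n set \<Rightarrow> bool" where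
  "complete_bipartite_on U F V\<^sub>1 V\<^sub>2 \<longleftrightarrow>
     V\<^sub>1 \<noteq> {} \<and> V\<^sub>2 \<noteq> {} \<and> V\<^sub>1 \<inter> V\<^sub>2 = {} \<and> V\<^sub>1 \<union> V\<^sub>2 = U \<and>
     F = {{i, j} | i j. i \<in> V\<^sub>1 \<and> j \<in> V\<^sub>2}"

definition has_4_cycle :: "'n set set \<Rightarrow> bool" where
  "has_4_cycle E \<longleftrightarrow>
     (\<exists>a b c d. distinct [a, b, c, d] \<and> {a, b} \<in> E \<and> {b, c} \<in> E \<and> {c, d} \<in> E \<and> {d, a} \<in> E)"

text \<open>Since \<open>axis i 1\<close> is the unit vector at \<open>i\<close>, a loop at \<open>i\<close> contributes
  twice that vector.\<close>

definition edge_polytope :: "'n::finite set set \<Rightarrow> (real ^ 'n) set" where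
  "edge_polytope E = convex hull {axis i 1 + axis j 1 | i j. {i, j} \<in> E}"

definition integer_lattice :: "(real ^ 'n) set" where
  "integer_lattice = {x. \<forall>i. x $ i \<in> \<int>}"

definition is_ehrhart_polynomial :: "(real ^ 'n::finite) set \<Rightarrow> real poly \<Rightarrow> bool" where
  "is_ehrhart_polynomial P f \<longleftrightarrow>
     int (degree f) = aff_dim P \<and>
     (\<forall>m::nat. m \<ge> 1 \<longrightarrow>
        poly f (real m) = real (card ((\<lambda>x. real m *\<^sub>R x) ` P \<inter> integer_lattice)))"

lemma is_ehrhart_polynomial_unique:
  assumes "is_ehrhart_polynomial P f" and "is_ehrhart_polynomial P g"
  shows "f = g"
proof (rule ccontr)
  assume "f \<noteq> g"
  hence "finite {x. poly (f - g) x = 0}"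
    by (intro poly_roots_finite) simp
  moreover have "real ` {1..} \<subseteq> {x. poly (f - g) x = 0}"
    using assms by (auto simp: is_ehrhart_polynomial_def)
  ultimately have "finite (real ` {1..})"
    by (rule rev_finite_subset)
  hence "finite {1::nat..}"
    by (rule finite_imageD) (simp add: inj_on_def)
  thus False
    by (simp add: infinite_Ici)
qed

definition ehrhart_polynomial :: "(real ^ 'n::finite) set \<Rightarrow> real poly" where
  "ehrhart_polynomial P = (THE f. is_ehrhart_polynomial P f)"

lemma ehrhart_polynomial_eqI:
  assumes "is_ehrhart_polynomial P f"
  shows "ehrhart_polynomial P = f"
  unfolding ehrhart_polynomial_def
  using assms is_ehrhart_polynomial_unique by blast

definition normalized_volume :: "(real ^ 'n::finite) set \<Rightarrow> real" where
  "normalized_volume P = fact (nat (aff_dim P)) * lead_coeff (ehrhart_polynomial P)"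

end

theory Submission
  imports Defs
begin

text \<open>
  In each of the three types the edge polytope is cut out by the obvious inequalities, and
  its lattice points can then be counted directly.

  The inequalities hold because a coordinate sum over a vertex set \<open>A\<close> is linear and
  counts, at the generator of an edge, how many ends the edge has in \<open>A\<close>
  (\<open>coordinate_sum_edge_polytope\<close>). They suffice because a point satisfying them
  can be written as \<open>a + b\<close>, where \<open>a\<close> and \<open>b\<close> are
  probability vectors supported on vertex sets all of whose pairs are edges; weighting the edge
  \<open>{i, j}\<close> by \<open>a\<^sub>i b\<^sub>j\<close> exhibits \<open>a + b\<close> as a convex
  combination of generators (\<open>add_mem_edge_polytope\<close>). Only the choice of
  \<open>a\<close> and \<open>b\<close> depends on the type. Writing \<open>x(A)\<close> for the sum
  of the coordinates of \<open>x\<close> in \<open>A\<close>, the lattice points of the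
  \<open>m\<close>-th dilate are thus the vectors of natural numbers such that:

  \<^item> \<open>x(V\<^sub>1) = x(V\<^sub>2) = m\<close> in type \<open>\<alpha>\<close>;
  \<^item> \<open>x(V\<^sub>1) \<le> m\<close>, \<open>x(V\<^sub>2) \<le> m\<close> and the total is
    \<open>2m\<close> in type \<open>\<beta>\<close>;
  \<^item> \<open>x(L) \<ge> m\<close> and the total is \<open>2m\<close> in type \<open>\<gamma>\<close>,
    where \<open>L\<close> is the set of vertices carrying a loop.

  The first two kinds are pairs of weak compositions. For the third, list the vertices of
  \<open>L\<close> and stop at the first one, the \<open>j\<close>-th, at which the partial sum
  reaches \<open>m\<close>. The vectors with a given \<open>j\<close> are, after subtracting
  one at that vertex, counted as in type \<open>\<beta>\<close>, with the bound \<open>m - 1\<close>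
  on the vertices before it and \<open>m\<close> on those after it or without a loop; they give
  the \<open>j\<close>-th summand (\<open>card_large_block_sum\<close>).

  It remains to know the dimension. Each of the graphs retracts onto a single edge or loop, and
  then the dimension is the number of vertices outside that edge or loop
  (\<open>aff_dim_edge_polytope\<close>). This matches the degrees of the polynomials found,
  whose leading coefficients yield the volumes.
\<close>

section \<open>Weak compositions\<close>

text \<open>Functions are made zero off \<open>A\<close>, so that compositions supported on
  different sets can be added pointwise.\<close>

definition weak_compositions :: "'a set \<Rightarrow> nat \<Rightarrow> ('a \<Rightarrow> nat) set" where
  "weak_compositions A n = {f. (\<forall>i. i \<notin> A \<longrightarrow> f i = 0) \<and> sum f A = n}"

lemma weak_compositions_insert_Suc:
  assumes "finite A" "a \<notin> A"
  shows "weak_compositions (insert a A) (Suc n) =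
    weak_compositions A (Suc n) \<union> (\<lambda>f. f(a := Suc (f a))) ` weak_compositions (insert a A) n"
proof (intro equalityI subsetI)
  fix f assume f: "f \<in> weak_compositions (insert a A) (Suc n)"
  show "f \<in> weak_compositions A (Suc n) \<union>
    (\<lambda>f. f(a := Suc (f a))) ` weak_compositions (insert a A) n"
  proof (cases "f a")
    case 0
    hence "f i = 0" if "i \<notin> A" for i
      using f that by (cases "i = a") (auto simp: weak_compositions_def)
    with f assms 0 show ?thesis by (auto simp: weak_compositions_def)
  next
    case (Suc k)
    have "sum (f(a := k)) A = sum f A"
      using assms by (intro sum.cong) auto
    hence "f(a := k) \<in> weak_compositions (insert a A) n"
      using f assms Suc by (auto simp: weak_compositions_def)
    moreover have "f = (f(a := k))(a := Suc ((f(a := k)) a))"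
      using Suc by auto
    ultimately show ?thesis by blast
  qed
next
  fix f assume "f \<in> weak_compositions A (Suc n) \<union>
    (\<lambda>f. f(a := Suc (f a))) ` weak_compositions (insert a A) n"
  moreover have "sum (g(a := Suc (g a))) A = sum g A" for g :: "'a \<Rightarrow> nat"
    using assms by (intro sum.cong) auto
  ultimately show "f \<in> weak_compositions (insert a A) (Suc n)"
    using assms by (auto simp: weak_compositions_def)
qed

text \<open>Splitting off the compositions that vanish at a chosen element is Pascal's rule.
  With truncated subtraction the formula also covers the empty set.\<close>

lemma finite_card_weak_compositions:
  assumes "finite A"
  shows "finite (weak_compositions A n) \<and>
    card (weak_compositions A n) = (n + card A - 1) choose n"
  using assms
proof (induction A arbitrary: n rule: finite_induct)
  case empty
  have "weak_compositions {} n = (if n = 0 then {\<lambda>_. 0} else {} :: ('a \<Rightarrow> nat) set)"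
    by (auto simp: weak_compositions_def)
  thus ?case by simp
next
  case (insert a A)
  show ?case
  proof (induction n)
    case 0
    have "weak_compositions (insert a A) 0 = {\<lambda>_. 0}"
      using insert.hyps by (auto simp: weak_compositions_def fun_eq_iff) metis
    thus ?case by simp
  next
    case (Suc n)
    let ?up = "\<lambda>f::'a \<Rightarrow> nat. f(a := Suc (f a))"
    have inj: "inj ?up"
      by (rule inj_on_inverseI[of _ "\<lambda>f. f(a := f a - 1)"]) simp
    have "weak_compositions A (Suc n) \<inter> ?up ` weak_compositions (insert a A) n = {}"
      using insert.hyps by (auto simp: weak_compositions_def fun_eq_iff)
    hence "card (weak_compositions (insert a A) (Suc n)) =
        ((Suc n + card A - 1) choose Suc n) + ((n + card (insert a A) - 1) choose n)"
      using insert.IH Suc.IH insert.hyps inj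
      by (simp add: weak_compositions_insert_Suc card_Un_disjoint card_image inj_on_subset)
    thus ?case
      using insert.IH Suc.IH insert.hyps
      by (simp add: weak_compositions_insert_Suc)
  qed
qed

lemma card_weak_compositions_insert:
  assumes "finite A" "a \<notin> A"
  shows "card (weak_compositions (insert a A) n) = (card A + n) choose card A"
proof -
  have "card (weak_compositions (insert a A) n) = (n + card A) choose n"
    using finite_card_weak_compositions[of "insert a A" n] assms by simp
  also have "\<dots> = (card A + n) choose card A"
    using binomial_symmetric[of n "n + card A"] by (simp add: add.commute)
  finally show ?thesis .
qed

lemma card_weak_compositions_nonempty:
  assumes "finite A" "A \<noteq> {}"
  shows "card (weak_compositions A n) = (card A + n - 1) choose (card A - 1)"
proof -
  obtain a B where "A = insert a B" "a \<notin> B" "finite B"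
    using assms by (metis finite.cases finite_insert mk_disjoint_insert all_not_in_conv)
  thus ?thesis by (simp add: card_weak_compositions_insert)
qed

text \<open>Supports may overlap in one point \<open>v\<close>: the value of each summand at
  \<open>v\<close> is forced by its prescribed total. The overlap is what turns equalities for
  the two block sums into inequalities below.\<close>

lemma inj_on_add_weak_compositions:
  assumes "finite A" "A \<inter> B \<subseteq> {v}"
  shows "inj_on (\<lambda>(g, h) i. g i + h i) (weak_compositions A n \<times> weak_compositions B m)"
proof (rule inj_onI, clarify)
  fix g h g' h'
  assume g: "g \<in> weak_compositions A n" "g' \<in> weak_compositions A n"
    and h: "h \<in> weak_compositions B m" "h' \<in> weak_compositions B m"
    and eq: "(\<lambda>i. g i + h i) = (\<lambda>i. g' i + h' i)"
  have eq: "g i + h i = g' i + h' i" for i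
    using eq by (rule fun_cong)
  have off: "g i = g' i" if "i \<noteq> v" for i
  proof (cases "i \<in> A")
    case True
    hence "h i = 0" "h' i = 0"
      using h that assms(2) by (auto simp: weak_compositions_def)
    with eq[of i] show ?thesis by simp
  qed (use g in \<open>auto simp: weak_compositions_def\<close>)
  have "g v = g' v"
  proof (cases "v \<in> A")
    case True
    have "sum g (A - {v}) = sum g' (A - {v})"
      using off by (intro sum.cong) auto
    moreover have "sum g A = sum g' A"
      using g by (auto simp: weak_compositions_def)
    ultimately show ?thesis
      using sum.remove[OF assms(1) True, of g] sum.remove[OF assms(1) True, of g'] by simp
  qed (use g in \<open>auto simp: weak_compositions_def\<close>)
  with off have "g = g'" by fastforce
  with eq show "g = g' \<and> h = h'" by fastforce
qed

lemma card_two_block_sums: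
  fixes A B :: "'a::finite set"
  assumes "A \<noteq> {}" "B \<noteq> {}" "A \<inter> B = {}" "A \<union> B = UNIV"
  shows "card {f. sum f A = n \<and> sum f B = m} =
    ((card A + n - 1) choose (card A - 1)) * ((card B + m - 1) choose (card B - 1))"
proof -
  let ?add = "\<lambda>(g::'a \<Rightarrow> nat, h) i. g i + h i"
  have "{f. sum f A = n \<and> sum f B = m} =
    ?add ` (weak_compositions A n \<times> weak_compositions B m)" (is "?S = ?T")
  proof (intro equalityI subsetI)
    fix f assume f: "f \<in> ?S"
    let ?g = "\<lambda>i. if i \<in> A then f i else 0" and ?h = "\<lambda>i. if i \<in> B then f i else 0"
    have "?g \<in> weak_compositions A n" "?h \<in> weak_compositions B m"
      using f by (auto simp: weak_compositions_def)
    moreover have "f = ?add (?g, ?h)"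
      using assms(3,4) by fastforce
    ultimately show "f \<in> ?T" by blast
  next
    fix f assume "f \<in> ?T"
    then obtain g h where gh: "g \<in> weak_compositions A n" "h \<in> weak_compositions B m"
      and f: "f = ?add (g, h)" by auto
    have "sum h A = 0" "sum g B = 0"
      using gh assms(3) by (auto simp: weak_compositions_def)
    thus "f \<in> ?S"
      using gh f by (auto simp: weak_compositions_def sum.distrib)
  qed
  thus ?thesis
    using inj_on_add_weak_compositions[of A B undefined n m] assms
    by (simp add: card_image card_cartesian_product card_weak_compositions_nonempty)
qed

text \<open>The value at \<open>v\<close> is the sum of the two slacks, so these functions are the
  sums of a composition of \<open>n\<close> on \<open>A\<close> with \<open>v\<close> and one of
  \<open>m\<close> on \<open>B\<close> with \<open>v\<close>.\<close>

lemma card_bounded_block_sums: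
  fixes A B :: "'a::finite set"
  assumes "v \<notin> A" "v \<notin> B" "A \<inter> B = {}" "insert v (A \<union> B) = UNIV"
  shows "card {f. sum f UNIV = n + m \<and> sum f A \<le> n \<and> sum f B \<le> m} =
    ((card A + n) choose card A) * ((card B + m) choose card B)"
proof -
  let ?add = "\<lambda>(g::'a \<Rightarrow> nat, h) i. g i + h i"
  have split: "sum f UNIV = f v + sum f A + sum f B" for f :: "'a \<Rightarrow> nat"
    unfolding assms(4)[symmetric] using assms(1-3)
    by (simp add: sum.union_disjoint)
  have "{f. sum f UNIV = n + m \<and> sum f A \<le> n \<and> sum f B \<le> m} =
    ?add ` (weak_compositions (insert v A) n \<times> weak_compositions (insert v B) m)" (is "?S = ?T")
  proof (intro equalityI subsetI)
    fix f assume f: "f \<in> ?S"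
    let ?g = "\<lambda>i. if i = v then n - sum f A else if i \<in> A then f i else 0"
    let ?h = "\<lambda>i. if i = v then m - sum f B else if i \<in> B then f i else 0"
    have "sum ?g A = sum f A" "sum ?h B = sum f B"
      using assms(1,2) by (auto intro!: sum.cong)
    hence "?g \<in> weak_compositions (insert v A) n" "?h \<in> weak_compositions (insert v B) m"
      using f assms(1,2) by (auto simp: weak_compositions_def)
    moreover have "f = ?add (?g, ?h)"
    proof
      fix i show "f i = ?add (?g, ?h) i"
        using f split[of f] assms by (cases "i = v") auto
    qed
    ultimately show "f \<in> ?T" by blast
  next
    fix f assume "f \<in> ?T"
    then obtain g h where gh: "g \<in> weak_compositions (insert v A) n"
      "h \<in> weak_compositions (insert v B) m" and f: "f = ?add (g, h)" by auto
    have "sum h A = 0" "sum g B = 0"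
      using gh assms(1-3) by (auto simp: weak_compositions_def)
    thus "f \<in> ?S"
      using gh f assms(1,2) split[of f] by (auto simp: weak_compositions_def sum.distrib)
  qed
  thus ?thesis
    using inj_on_add_weak_compositions[of "insert v A" "insert v B" v n m] assms
    by (simp add: card_image card_cartesian_product card_weak_compositions_insert)
qed

text \<open>Adding a vertex \<open>l\<close> to \<open>L\<close> brings in exactly the functions whose
  sum first reaches \<open>Suc n\<close> at \<open>l\<close>. Their value at \<open>l\<close> is
  positive; decreasing it by one leaves sum at most \<open>n\<close> on \<open>L\<close> and at
  most \<open>m\<close> on the remaining vertices, with no other restriction than the
  total.\<close>

lemma card_large_block_sum:
  fixes L :: "'a::finite set"
  shows "card {f. sum f UNIV = Suc n + m \<and> Suc n \<le> sum f L} =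
    (\<Sum>j = 1..card L. ((j - 1 + n) choose (j - 1)) * ((CARD('a) - j + m) choose (CARD('a) - j)))"
proof (induction L rule: finite_induct[OF finite])
  case 1
  then show ?case by simp
next
  case (2 l L)
  define S where "S = (\<lambda>L::'a set. {f::'a \<Rightarrow> nat. sum f UNIV = Suc n + m \<and> Suc n \<le> sum f L})"
  define R where "R = - insert l L"
  define T where "T = {f::'a \<Rightarrow> nat. sum f UNIV = n + m \<and> sum f L \<le> n \<and> sum f R \<le> m}"
  let ?up = "\<lambda>f::'a \<Rightarrow> nat. f(l := Suc (f l))"
  have split: "sum f UNIV = f l + sum f L + sum f R" for f :: "'a \<Rightarrow> nat"
    using 2(2) sum.union_disjoint[of "insert l L" R f] by (simp add: R_def)
  have upL: "sum (f(l := k)) L = sum f L" and upR: "sum (f(l := k)) R = sum f R"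
    for f :: "'a \<Rightarrow> nat" and k
    using 2(2) by (auto simp: R_def intro!: sum.cong)
  have upU: "sum (f(l := k)) UNIV + f l = sum f UNIV + k" for f :: "'a \<Rightarrow> nat" and k
    using split[of f] split[of "f(l := k)"] unfolding upL upR fun_upd_same by simp
  have S: "S (insert l L) = S L \<union> ?up ` T"
  proof (intro equalityI subsetI)
    fix f assume f: "f \<in> S (insert l L)"
    show "f \<in> S L \<union> ?up ` T"
    proof (cases "Suc n \<le> sum f L")
      case True
      thus ?thesis using f by (auto simp: S_def)
    next
      case False
      hence "f l > 0" using f 2(2) by (auto simp: S_def)
      moreover have "f(l := f l - 1) \<in> T"
        using False f 2(2) split[of f] upU[of f "f l - 1"] \<open>f l > 0\<close>
        unfolding S_def T_def mem_Collect_eq upL upR by simp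
      moreover from \<open>f l > 0\<close> have "f = ?up (f(l := f l - 1))"
        by auto
      ultimately show ?thesis by blast
    qed
  next
    fix f assume "f \<in> S L \<union> ?up ` T"
    thus "f \<in> S (insert l L)"
    proof
      assume "f \<in> ?up ` T"
      then obtain g where "g \<in> T" "f = ?up g" by auto
      thus ?thesis
        using 2(2) split[of g] upU[of g "Suc (g l)"] upL[of g "Suc (g l)"]
        unfolding S_def T_def mem_Collect_eq by simp
    qed (use 2(2) in \<open>auto simp: S_def\<close>)
  qed
  have "?up g \<notin> S L" if "g \<in> T" for g
    using that unfolding S_def T_def mem_Collect_eq upL by simp
  hence disj: "S L \<inter> ?up ` T = {}" by blast
  have inj: "inj ?up"
    by (rule inj_on_inverseI[of _ "\<lambda>f. f(l := f l - 1)"]) simp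
  have fin: "finite {f::'a \<Rightarrow> nat. sum f UNIV = k \<and> Q f}" for k Q
    using finite_card_weak_compositions[OF finite, of "UNIV::'a set" k]
    by (auto simp: weak_compositions_def)
  have "card (S (insert l L)) = card (S L) + card T"
    unfolding S using disj fin inj
    by (subst card_Un_disjoint) (auto simp: S_def T_def card_image inj_on_subset)
  moreover have "card T = ((card L + n) choose card L) * ((card R + m) choose card R)"
    unfolding T_def using 2(2) by (intro card_bounded_block_sums[of l]) (auto simp: R_def)
  moreover have "card R = CARD('a) - Suc (card L)"
    using 2(2) card_Diff_subset[of "insert l L" UNIV] by (simp add: R_def Compl_eq_Diff_UNIV)
  ultimately show ?case
    using 2(2,3) by (simp add: S_def)
qed

section \<open>Edge polytopes\<close>

lemma axis_component: "axis i (1::real) $ j = of_bool (i = j)"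
  by (auto simp: axis_def)

lemma coordinate_sum_edge_polytope:
  fixes x :: "real ^ 'n::finite"
  assumes "convex I" "\<And>i j. {i, j} \<in> E \<Longrightarrow> of_bool (i \<in> A) + of_bool (j \<in> A) \<in> I"
    and "x \<in> edge_polytope E"
  shows "(\<Sum>i\<in>A. x $ i) \<in> (I :: real set)"
proof -
  let ?s = "\<lambda>x::real^'n. \<Sum>i\<in>A. x $ i"
  have "linear ?s"
    by (intro linearI) (auto simp: sum.distrib sum_distrib_left)
  hence "convex (?s -` I)"
    using assms(1) by (rule convex_linear_vimage)
  moreover have "{axis i 1 + axis j 1 | i j. {i, j} \<in> E} \<subseteq> ?s -` I"
  proof
    fix y :: "real^'n" assume "y \<in> {axis i 1 + axis j 1 | i j. {i, j} \<in> E}"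
    then obtain i j where "{i, j} \<in> E" "y = axis i 1 + axis j 1" by blast
    moreover have "?s (axis k 1) = of_bool (k \<in> A)" for k
      by (simp add: axis_component of_bool_def)
    ultimately show "y \<in> ?s -` I"
      using assms(2) by (simp add: sum.distrib)
  qed
  ultimately have "edge_polytope E \<subseteq> ?s -` I"
    unfolding edge_polytope_def by (intro hull_minimal)
  thus ?thesis using assms(3) by auto
qed

lemma edge_polytope_nonneg:
  assumes "x \<in> edge_polytope E"
  shows "0 \<le> x $ i"
  using coordinate_sum_edge_polytope[of "{0..}" E "{i}" x] assms by auto

lemma edge_polytope_sum:
  assumes "x \<in> edge_polytope E"
  shows "(\<Sum>i\<in>UNIV. x $ i) = 2"
  using coordinate_sum_edge_polytope[of "{2}" E UNIV x] assms by auto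

lemma sum_axis: "(\<Sum>i\<in>UNIV. (x $ i) *\<^sub>R axis i 1) = (x :: real^'n::finite)"
  using basis_expansion[of x] by (simp add: scalar_mult_eq_scaleR)

text \<open>The point is the average of the generators \<open>axis i 1 + axis j 1\<close> with
  respect to the product of the two probability vectors, taken one factor at a time.\<close>

lemma add_mem_edge_polytope:
  fixes a b :: "real^'n::finite"
  assumes edges: "\<And>i j. i \<in> A \<Longrightarrow> j \<in> B \<Longrightarrow> {i, j} \<in> E"
    and a: "\<And>i. 0 \<le> a $ i" "\<And>i. i \<notin> A \<Longrightarrow> a $ i = 0" "(\<Sum>i\<in>UNIV. a $ i) = 1"
    and b: "\<And>i. 0 \<le> b $ i" "\<And>i. i \<notin> B \<Longrightarrow> b $ i = 0" "(\<Sum>i\<in>UNIV. b $ i) = 1"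
  shows "a + b \<in> edge_polytope E"
proof -
  have conv: "convex (edge_polytope E)"
    by (simp add: edge_polytope_def)
  \<comment> \<open>Averaging over one factor; used with \<open>z\<close> a unit vector, then with \<open>z = a\<close>.\<close>
  have point: "y \<in> edge_polytope E"
    if c: "\<And>i. 0 \<le> c $ i" "\<And>i. i \<notin> C \<Longrightarrow> c $ i = 0" "(\<Sum>i\<in>UNIV. c $ i) = 1"
      and gen: "\<And>i. i \<in> C \<Longrightarrow> axis i 1 + z \<in> edge_polytope E" and y: "y = c + z"
    for c y z :: "real^'n" and C
  proof -
    have supp: "(\<Sum>i\<in>C. F i) = (\<Sum>i\<in>UNIV. F i)" if "\<And>i. c $ i = 0 \<Longrightarrow> F i = 0"
      for F :: "'n \<Rightarrow> 'b::comm_monoid_add"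
      using that c(2) by (intro sum.mono_neutral_left) auto
    have "(\<Sum>i\<in>C. (c $ i) *\<^sub>R (axis i 1 + z)) \<in> edge_polytope E"
      using c gen by (intro convex_sum[OF _ conv]) (auto simp: supp)
    also have "(\<Sum>i\<in>C. (c $ i) *\<^sub>R (axis i 1 + z)) = (\<Sum>i\<in>UNIV. (c $ i) *\<^sub>R (axis i 1 + z))"
      by (rule supp) simp
    also have "\<dots> = y"
      using c(3) y by (simp add: scaleR_add_right sum.distrib sum_axis scaleR_left.sum[symmetric])
    finally show ?thesis .
  qed
  have "axis j 1 + a \<in> edge_polytope E" if "j \<in> B" for j
  proof (rule point[OF a])
    fix i assume "i \<in> A"
    hence "{i, j} \<in> E" using edges that by blast
    thus "axis i 1 + axis j 1 \<in> edge_polytope E"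
      unfolding edge_polytope_def by (intro hull_inc) blast
  qed auto
  thus ?thesis
    using point[OF b, where z = a and y = "a + b"] by (simp add: add.commute)
qed

text \<open>Here \<open>r\<close> is a retraction of the graph onto the edge, or loop if
  \<open>a = b\<close>, with ends \<open>a\<close> and \<open>b\<close>. Relative to the generator of
  that edge, the generator of \<open>{i, j}\<close> is the sum of the vectors
  \<open>e\<^sub>i - e\<^bsub>r i\<^esub>\<close> and \<open>e\<^sub>j - e\<^bsub>r j\<^esub>\<close>, and
  the edge from \<open>i\<close> to \<open>a\<close> or \<open>b\<close> gives the first of them
  alone. Hence these vectors, for \<open>i\<close> other than \<open>a\<close> and
  \<open>b\<close>, form a basis of the direction space; they are independent because only one
  of them is nonzero in coordinate \<open>i\<close>.\<close>

lemma aff_dim_edge_polytope: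
  fixes E :: "'n::finite set set"
  assumes fixed: "r a = a" "r b = b" and ab: "{a, b} \<in> E"
    and hom: "\<And>i j. {i, j} \<in> E \<Longrightarrow> {r i, r j} = {a, b}"
    and adj: "\<And>i. {i, a} \<in> E \<or> {i, b} \<in> E"
  shows "aff_dim (edge_polytope E) = int (CARD('n) - card {a, b})"
proof -
  define X where "X = {axis i 1 + axis j (1::real) | i j. {i, j} \<in> E}"
  define x0 where "x0 = axis a 1 + axis b (1::real)"
  define d where "d = (\<lambda>i. axis i 1 - axis (r i) (1::real))"
  define D where "D = d ` (- {a, b})"
  have r: "r i \<in> {a, b}" for i
    using adj[of i] hom by blast
  have r_sum: "axis (r i) 1 + axis (r j) 1 = x0" if "{i, j} \<in> E" for i j
    using hom[OF that] by (auto simp: x0_def doubleton_eq_iff add.commute)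
  have comp: "d j $ i = of_bool (j = i)" if "i \<notin> {a, b}" for i j
    using that r[of j] by (auto simp: d_def axis_component)
  have inj: "inj_on d (- {a, b})"
  proof (rule inj_onI)
    fix i j assume i: "i \<in> - {a, b}" and eq: "d i = d j"
    have "of_bool (i = i) = (of_bool (j = i) :: real)"
      using comp[of i i] comp[of i j] i unfolding eq by simp
    thus "i = j" by (simp split: if_splits)
  qed
  have "dim ((+) (- x0) ` X) = card D"
  proof (rule dim_unique[OF _ _ _ refl])
    show "D \<subseteq> (+) (- x0) ` X"
    proof
      fix y assume "y \<in> D"
      then obtain i where y: "y = d i" by (auto simp: D_def)
      obtain k where k: "{i, k} \<in> E" "r k = k"
        using adj[of i] fixed by auto
      have "y = - x0 + (axis i 1 + axis k 1)"
        using r_sum[OF k(1)] k(2) by (auto simp: y d_def algebra_simps)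
      with k(1) show "y \<in> (+) (- x0) ` X" by (auto simp: X_def)
    qed
    have span: "d i \<in> span D" for i
    proof (cases "i \<in> {a, b}")
      case True
      hence "d i = 0" using fixed by (auto simp: d_def)
      thus ?thesis by (simp add: span_zero)
    qed (auto simp: D_def intro: span_base)
    show "(+) (- x0) ` X \<subseteq> span D"
    proof
      fix y assume "y \<in> (+) (- x0) ` X"
      then obtain i j where ij: "{i, j} \<in> E" "y = - x0 + (axis i 1 + axis j 1)"
        by (auto simp: X_def)
      have "y = d i + d j"
        using r_sum[OF ij(1)] ij(2) by (auto simp: d_def algebra_simps)
      thus "y \<in> span D" by (simp add: span span_add)
    qed
    show "independent D"
    proof (rule independent_if_scalars_zero)
      fix f x assume sum0: "(\<Sum>y\<in>D. f y *\<^sub>R y) = 0" and "x \<in> D"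
      then obtain i where i: "i \<notin> {a, b}" "x = d i" by (auto simp: D_def)
      have "0 = (\<Sum>y\<in>D. f y *\<^sub>R y) $ i" by (simp add: sum0)
      also have "\<dots> = (\<Sum>y\<in>D. f y * of_bool (y = x))"
        unfolding sum_component
      proof (rule sum.cong)
        fix y assume "y \<in> D"
        then obtain j where j: "j \<in> - {a, b}" "y = d j" by (auto simp: D_def)
        show "(f y *\<^sub>R y) $ i = f y * of_bool (y = x)"
          using comp[OF i(1), of j] i j inj_on_eq_iff[OF inj, of j i] by auto
      qed simp
      also have "\<dots> = f x"
        using \<open>x \<in> D\<close> by (simp add: of_bool_def if_distrib cong: if_cong) (simp add: D_def)
      finally show "f x = 0" by simp
    qed (simp add: D_def)
  qed
  moreover have "card D = CARD('n) - card {a, b}"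
    unfolding D_def card_image[OF inj]
    using card_Diff_subset[of "{a, b}" UNIV] by (simp add: Compl_eq_Diff_UNIV)
  moreover have "x0 \<in> X" using ab by (auto simp: X_def x0_def)
  hence "aff_dim X = int (dim ((+) (- x0) ` X))"
    by (intro aff_dim_eq_dim hull_inc)
  moreover have "aff_dim (edge_polytope E) = aff_dim X"
    by (simp add: edge_polytope_def aff_dim_convex_hull flip: X_def)
  ultimately show ?thesis by simp
qed

lemma card_lattice_points_edge_polytope:
  fixes E :: "'n::finite set set"
  assumes m: "m \<ge> 1"
    and S: "\<And>f. (\<chi> i. real (f i) / real m) \<in> edge_polytope E \<longleftrightarrow> f \<in> S"
  shows "card ((\<lambda>x. real m *\<^sub>R x) ` edge_polytope E \<inter> integer_lattice) = card S"
proof -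
  let ?P = "edge_polytope E"
  let ?v = "\<lambda>f::'n \<Rightarrow> nat. (\<chi> i. real (f i)) :: real ^ 'n"
  have v: "?v f = real m *\<^sub>R (\<chi> i. real (f i) / real m)" for f
    using m by (simp add: vec_eq_iff)
  have "(\<lambda>x. real m *\<^sub>R x) ` ?P \<inter> integer_lattice = ?v ` S"
  proof (intro equalityI subsetI)
    fix y assume "y \<in> (\<lambda>x. real m *\<^sub>R x) ` ?P \<inter> integer_lattice"
    then obtain x where x: "x \<in> ?P" "y = real m *\<^sub>R x" and y: "\<And>i. y $ i \<in> \<int>"
      by (auto simp: integer_lattice_def)
    have "y $ i \<in> \<nat>" for i
      using y[of i] edge_polytope_nonneg[OF x(1), of i] x(2) by (simp add: Nats_altdef2)
    hence "\<forall>i. \<exists>k. y $ i = real k"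
      by (meson Nats_cases)
    then obtain f where f: "\<And>i. y $ i = real (f i)"
      by metis
    have "x = (\<chi> i. real (f i) / real m)"
      using m x(2) by (simp add: vec_eq_iff flip: f)
    hence "f \<in> S" using x(1) S by simp
    moreover have "y = ?v f" by (simp add: vec_eq_iff f)
    ultimately show "y \<in> ?v ` S" by blast
  next
    fix y assume "y \<in> ?v ` S"
    then obtain f where f: "f \<in> S" "y = ?v f" by auto
    have "(\<chi> i. real (f i) / real m) \<in> ?P" using S f(1) by blast
    thus "y \<in> (\<lambda>x. real m *\<^sub>R x) ` ?P \<inter> integer_lattice"
      using f(2) v[of f] by (auto simp: integer_lattice_def)
  qed
  moreover have "inj_on ?v S"
    by (auto simp: inj_on_def vec_eq_iff)
  ultimately show ?thesis by (simp add: card_image)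
qed

section \<open>Binomial polynomials\<close>

definition binomial_poly :: "real \<Rightarrow> nat \<Rightarrow> real poly" where
  "binomial_poly c k = smult (1 / fact k) (\<Prod>i<k. [:c - real i, 1:])"

lemma poly_binomial_poly: "poly (binomial_poly c k) x = (c + x) gchoose k"
  by (simp add: binomial_poly_def poly_prod gbinomial_prod_rev atLeast0LessThan algebra_simps)

lemma degree_binomial_poly: "degree (binomial_poly c k) = k"
  by (simp add: binomial_poly_def degree_prod_eq_sum_degree)

lemma lead_coeff_binomial_poly: "lead_coeff (binomial_poly c k) = 1 / fact k"
  by (simp add: binomial_poly_def lead_coeff_smult lead_coeff_prod)

lemma degree_binomial_poly_mult:
  "degree (binomial_poly c k * binomial_poly c' l) = k + l"
  using lead_coeff_binomial_poly[of c k] lead_coeff_binomial_poly[of c' l]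
  by (subst degree_mult_eq) (auto simp: degree_binomial_poly)

lemma lead_coeff_binomial_poly_mult:
  "fact (k + l) * lead_coeff (binomial_poly c k * binomial_poly c' l) = real ((k + l) choose k)"
  unfolding lead_coeff_mult lead_coeff_binomial_poly
  by (simp add: binomial_fact)

lemma normalized_volume_eq:
  assumes "is_ehrhart_polynomial P f"
  shows "normalized_volume P = fact (degree f) * lead_coeff f"
proof -
  have "nat (aff_dim P) = degree f"
    using assms unfolding is_ehrhart_polynomial_def by (metis nat_int)
  thus ?thesis
    by (simp add: normalized_volume_def ehrhart_polynomial_eqI[OF assms])
qed

section \<open>The three types of graphs\<close>

lemma edge_polytope_complete_bipartite:
  fixes E :: "'n::finite set set"
  assumes "complete_bipartite_on UNIV E V\<^sub>1 V\<^sub>2"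
  shows "x \<in> edge_polytope E \<longleftrightarrow>
    (\<forall>i. 0 \<le> x $ i) \<and> (\<Sum>i\<in>V\<^sub>1. x $ i) = 1 \<and> (\<Sum>i\<in>V\<^sub>2. x $ i) = 1"
proof
  have disj: "V\<^sub>1 \<inter> V\<^sub>2 = {}" "V\<^sub>1 \<union> V\<^sub>2 = UNIV" and E: "E = {{i, j} | i j. i \<in> V\<^sub>1 \<and> j \<in> V\<^sub>2}"
    using assms by (auto simp: complete_bipartite_on_def)
  {
    assume x: "x \<in> edge_polytope E"
    have "(\<Sum>i\<in>V\<^sub>1. x $ i) \<in> {1}" "(\<Sum>i\<in>V\<^sub>2. x $ i) \<in> {1}"
      using disj by (intro coordinate_sum_edge_polytope[OF _ _ x]; auto simp: E doubleton_eq_iff)+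
    thus "(\<forall>i. 0 \<le> x $ i) \<and> (\<Sum>i\<in>V\<^sub>1. x $ i) = 1 \<and> (\<Sum>i\<in>V\<^sub>2. x $ i) = 1"
      using edge_polytope_nonneg[OF x] by auto
  next
    assume x: "(\<forall>i. 0 \<le> x $ i) \<and> (\<Sum>i\<in>V\<^sub>1. x $ i) = 1 \<and> (\<Sum>i\<in>V\<^sub>2. x $ i) = 1"
    let ?a = "(\<chi> i. if i \<in> V\<^sub>1 then x $ i else 0) :: real^'n"
    let ?b = "(\<chi> i. if i \<in> V\<^sub>2 then x $ i else 0) :: real^'n"
    have "?a + ?b \<in> edge_polytope E"
      using x by (intro add_mem_edge_polytope[of V\<^sub>1 V\<^sub>2]) (auto simp: E sum.If_cases)
    also have "?a + ?b = x"
      using disj by (auto simp: vec_eq_iff)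
    finally show "x \<in> edge_polytope E" .
  }
qed

text \<open>A point is split into its restrictions to \<open>V\<^sub>1\<close> and
  \<open>V\<^sub>2\<close>, each completed to total one at \<open>v\<close>; the loop at
  \<open>v\<close> is what allows both supports to contain \<open>v\<close>.\<close>

lemma edge_polytope_cone_bipartite:
  fixes E :: "'n::finite set set"
  assumes V: "v \<notin> V\<^sub>1" "v \<notin> V\<^sub>2" "V\<^sub>1 \<inter> V\<^sub>2 = {}" "insert v (V\<^sub>1 \<union> V\<^sub>2) = UNIV"
    and edges: "\<forall>i\<in>insert v V\<^sub>1. \<forall>j\<in>insert v V\<^sub>2. {i, j} \<in> E"
    and indep: "\<forall>i j. {i, j} \<in> E \<longrightarrow> \<not> {i, j} \<subseteq> V\<^sub>1 \<and> \<not> {i, j} \<subseteq> V\<^sub>2"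
  shows "x \<in> edge_polytope E \<longleftrightarrow> (\<forall>i. 0 \<le> x $ i) \<and>
    (\<Sum>i\<in>UNIV. x $ i) = 2 \<and> (\<Sum>i\<in>V\<^sub>1. x $ i) \<le> 1 \<and> (\<Sum>i\<in>V\<^sub>2. x $ i) \<le> 1"
proof
  assume x: "x \<in> edge_polytope E"
  have "(\<Sum>i\<in>V\<^sub>1. x $ i) \<in> {..1}" "(\<Sum>i\<in>V\<^sub>2. x $ i) \<in> {..1}"
    using indep by (intro coordinate_sum_edge_polytope[OF _ _ x]; fastforce)+
  thus "(\<forall>i. 0 \<le> x $ i) \<and>
    (\<Sum>i\<in>UNIV. x $ i) = 2 \<and> (\<Sum>i\<in>V\<^sub>1. x $ i) \<le> 1 \<and> (\<Sum>i\<in>V\<^sub>2. x $ i) \<le> 1"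
    using edge_polytope_nonneg[OF x] edge_polytope_sum[OF x] by auto
next
  assume x: "(\<forall>i. 0 \<le> x $ i) \<and>
    (\<Sum>i\<in>UNIV. x $ i) = 2 \<and> (\<Sum>i\<in>V\<^sub>1. x $ i) \<le> 1 \<and> (\<Sum>i\<in>V\<^sub>2. x $ i) \<le> 1"
  have split: "(\<Sum>i\<in>UNIV. y i) = y v + (\<Sum>i\<in>V\<^sub>1. y i) + (\<Sum>i\<in>V\<^sub>2. y i)" for y :: "'n \<Rightarrow> real"
    unfolding V(4)[symmetric] using V(1-3) by (simp add: sum.union_disjoint)
  define part where "part = (\<lambda>U. (\<chi> i. if i = v then 1 - (\<Sum>i\<in>U. x $ i)
    else if i \<in> U then x $ i else 0) :: real^'n)"
  have on: "(\<Sum>i\<in>U. part U $ i) = (\<Sum>i\<in>U. x $ i)" if "v \<notin> U" for U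
    using that by (auto simp: part_def intro!: sum.cong)
  have off: "(\<Sum>i\<in>U'. part U $ i) = 0" if "v \<notin> U'" "U \<inter> U' = {}" for U U'
    using that by (auto simp: part_def intro!: sum.neutral)
  have v: "part U $ v = 1 - (\<Sum>i\<in>U. x $ i)" for U
    by (simp add: part_def)
  have "part V\<^sub>1 + part V\<^sub>2 \<in> edge_polytope E"
  proof (rule add_mem_edge_polytope[of "insert v V\<^sub>1" "insert v V\<^sub>2"])
    show "{i, j} \<in> E" if "i \<in> insert v V\<^sub>1" "j \<in> insert v V\<^sub>2" for i j
      using that edges by blast
    show "(\<Sum>i\<in>UNIV. part V\<^sub>1 $ i) = 1" "(\<Sum>i\<in>UNIV. part V\<^sub>2 $ i) = 1"
      using V(1-3) by (auto simp: split v on off Int_commute)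
  qed (use x in \<open>auto simp: part_def\<close>)
  also have "part V\<^sub>1 + part V\<^sub>2 = x"
    unfolding vec_eq_iff
  proof
    fix i
    show "(part V\<^sub>1 + part V\<^sub>2) $ i = x $ i"
      using x V split[of "($) x"] by (cases "i = v") (auto simp: part_def)
  qed
  finally show "x \<in> edge_polytope E" .
qed

text \<open>Since every vertex of \<open>L\<close> is joined to every vertex, one probability
  vector may be any on \<open>L\<close> and the other is unrestricted. The restriction of the
  point to \<open>L\<close>, rescaled to total one, serves as the first; as the total on
  \<open>L\<close> is at least one, the rescaling shrinks it and the rest stays
  nonnegative.\<close>

lemma edge_polytope_join_clique:
  fixes E :: "'n::finite set set"
  assumes edges: "\<forall>i\<in>L. \<forall>j. {i, j} \<in> E"
    and cover: "\<forall>i j. {i, j} \<in> E \<longrightarrow> i \<in> L \<or> j \<in> L"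
  shows "x \<in> edge_polytope E \<longleftrightarrow>
    (\<forall>i. 0 \<le> x $ i) \<and> (\<Sum>i\<in>UNIV. x $ i) = 2 \<and> 1 \<le> (\<Sum>i\<in>L. x $ i)"
proof
  assume x: "x \<in> edge_polytope E"
  have "(\<Sum>i\<in>L. x $ i) \<in> {1..}"
    using cover by (intro coordinate_sum_edge_polytope[OF _ _ x]) (auto simp: of_bool_def)
  thus "(\<forall>i. 0 \<le> x $ i) \<and> (\<Sum>i\<in>UNIV. x $ i) = 2 \<and> 1 \<le> (\<Sum>i\<in>L. x $ i)"
    using edge_polytope_nonneg[OF x] edge_polytope_sum[OF x] by auto
next
  define s where "s = (\<Sum>i\<in>L. x $ i)"
  define b where "b = ((\<chi> i. if i \<in> L then x $ i / s else 0) :: real^'n)"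
  assume "(\<forall>i. 0 \<le> x $ i) \<and> (\<Sum>i\<in>UNIV. x $ i) = 2 \<and> 1 \<le> (\<Sum>i\<in>L. x $ i)"
  hence x: "\<And>i. 0 \<le> x $ i" "(\<Sum>i\<in>UNIV. x $ i) = 2" "1 \<le> s"
    by (auto simp: s_def)
  have sum_b: "(\<Sum>i\<in>UNIV. b $ i) = 1"
    using x(3) by (simp add: b_def sum.If_cases flip: sum_divide_distrib s_def)
  have "b $ i \<le> x $ i" for i
    using x(1)[of i] x(3) by (simp add: b_def divide_le_eq mult_le_cancel_left1)
  hence "b + (x - b) \<in> edge_polytope E"
    using x sum_b
    edges by (intro add_mem_edge_polytope[of L UNIV]) (auto simp: b_def sum_subtractf)
  thus "x \<in> edge_polytope E" by simp
qed

lemma is_ehrhart_polynomial_complete_bipartite: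
  fixes E :: "'n::finite set set"
  assumes "complete_bipartite_on UNIV E V\<^sub>1 V\<^sub>2"
  shows "is_ehrhart_polynomial (edge_polytope E)
    (binomial_poly (real (card V\<^sub>1) - 1) (card V\<^sub>1 - 1) *
     binomial_poly (real (card V\<^sub>2) - 1) (card V\<^sub>2 - 1))"
proof -
  have V: "V\<^sub>1 \<noteq> {}" "V\<^sub>2 \<noteq> {}" "V\<^sub>1 \<inter> V\<^sub>2 = {}" "V\<^sub>1 \<union> V\<^sub>2 = UNIV"
    and E: "E = {{i, j} | i j. i \<in> V\<^sub>1 \<and> j \<in> V\<^sub>2}"
    using assms by (auto simp: complete_bipartite_on_def)
  obtain a b where ab: "a \<in> V\<^sub>1" "b \<in> V\<^sub>2" using V by blast
  hence "a \<noteq> b" using V by auto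
  have pos: "card V\<^sub>1 > 0" "card V\<^sub>2 > 0"
    using V by (auto simp: card_gt_0_iff)
  have "CARD('n) = card V\<^sub>1 + card V\<^sub>2"
    using V card_Un_disjoint[of V\<^sub>1 V\<^sub>2] by simp
  moreover have "aff_dim (edge_polytope E) = int (CARD('n) - card {a, b})"
  proof (rule aff_dim_edge_polytope[where r = "\<lambda>i. if i \<in> V\<^sub>1 then a else b"])
    have edge: "{i, j} \<in> E" if "i \<in> V\<^sub>1" "j \<in> V\<^sub>2" for i j
      using that E by blast
    show "{a, b} \<in> E" using ab by (rule edge)
    show "{i, a} \<in> E \<or> {i, b} \<in> E" for i
      using edge[of i b] edge[of a i] ab V(4) by (auto simp: insert_commute)
  qed (use ab V in \<open>auto simp: E doubleton_eq_iff\<close>)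
  ultimately have dim: "aff_dim (edge_polytope E) = int ((card V\<^sub>1 - 1) + (card V\<^sub>2 - 1))"
    using \<open>a \<noteq> b\<close> pos by simp
  have "card ((\<lambda>x. real m *\<^sub>R x) ` edge_polytope E \<inter> integer_lattice) =
      card {f. sum f V\<^sub>1 = m \<and> sum f V\<^sub>2 = m}" if "m \<ge> 1" for m
    using that
    by (intro card_lattice_points_edge_polytope)
      (auto simp: edge_polytope_complete_bipartite[OF assms] divide_eq_eq
        simp flip: sum_divide_distrib of_nat_sum)
  moreover have "real ((card A + m - 1) choose (card A - 1)) =
      (real (card A) - 1 + real m) gchoose (card A - 1)" if "card A > 0" for A :: "'n set" and m
    using that by (simp add: binomial_gbinomial of_nat_diff algebra_simps)
  ultimately show ?thesis
    unfolding is_ehrhart_polynomial_def degree_binomial_poly_mult dim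
    using V pos by (auto simp: card_two_block_sums poly_binomial_poly)
qed

lemma is_ehrhart_polynomial_cone_bipartite:
  fixes E :: "'n::finite set set"
  assumes V: "v \<notin> V\<^sub>1" "v \<notin> V\<^sub>2" "V\<^sub>1 \<inter> V\<^sub>2 = {}" "insert v (V\<^sub>1 \<union> V\<^sub>2) = UNIV"
    and edges: "\<forall>i\<in>insert v V\<^sub>1. \<forall>j\<in>insert v V\<^sub>2. {i, j} \<in> E"
    and indep: "\<forall>i j. {i, j} \<in> E \<longrightarrow> \<not> {i, j} \<subseteq> V\<^sub>1 \<and> \<not> {i, j} \<subseteq> V\<^sub>2"
  shows "is_ehrhart_polynomial (edge_polytope E)
    (binomial_poly (real (card V\<^sub>1)) (card V\<^sub>1) * binomial_poly (real (card V\<^sub>2)) (card V\<^sub>2))"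
proof -
  have "CARD('n) = Suc (card V\<^sub>1 + card V\<^sub>2)"
    unfolding V(4)[symmetric] using V(1-3) by (simp add: card_Un_disjoint)
  moreover have adj: "{i, v} \<in> E" for i
  proof -
    have "i \<in> insert v (V\<^sub>1 \<union> V\<^sub>2)" using V(4) by blast
    thus ?thesis using edges by (auto simp: insert_commute)
  qed
  hence "aff_dim (edge_polytope E) = int (CARD('n) - card {v, v})"
    using adj[of v] by (intro aff_dim_edge_polytope[where r = "\<lambda>_. v"]) auto
  ultimately have dim: "aff_dim (edge_polytope E) = int (card V\<^sub>1 + card V\<^sub>2)"
    by simp
  have "card ((\<lambda>x. real m *\<^sub>R x) ` edge_polytope E \<inter> integer_lattice) =
      card {f. sum f UNIV = m + m \<and> sum f V\<^sub>1 \<le> m \<and> sum f V\<^sub>2 \<le> m}" if "m \<ge> 1" for m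
    using that
    by (intro card_lattice_points_edge_polytope)
      (auto simp: edge_polytope_cone_bipartite[OF assms] divide_eq_eq divide_le_eq
        simp flip: sum_divide_distrib of_nat_sum)
  thus ?thesis
    unfolding is_ehrhart_polynomial_def degree_binomial_poly_mult dim
    using V by (simp add: card_bounded_block_sums poly_binomial_poly binomial_gbinomial)
qed

definition join_clique_ehrhart :: "nat \<Rightarrow> nat \<Rightarrow> real poly" where
  "join_clique_ehrhart p d =
    (\<Sum>j = 1..p. binomial_poly (real j - 2) (j - 1) * binomial_poly (real (d - j)) (d - j))"

text \<open>All summands have the same degree and positive leading coefficients, so these do
  not cancel.\<close>

lemma degree_lead_coeff_join_clique_ehrhart:
  assumes "1 \<le> p" "p \<le> d"
  shows "degree (join_clique_ehrhart p d) = d - 1"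
    and "fact (d - 1) * lead_coeff (join_clique_ehrhart p d) =
      real (\<Sum>j = 1..p. (d - 1) choose (j - 1))"
proof -
  let ?t = "\<lambda>j. binomial_poly (real j - 2) (j - 1) * binomial_poly (real (d - j)) (d - j)"
  have deg: "degree (?t j) = d - 1" if "j \<in> {1..p}" for j
    using that assms by (simp add: degree_binomial_poly_mult)
  have "fact (d - 1) * coeff (?t j) (d - 1) = real ((d - 1) choose (j - 1))" if "j \<in> {1..p}" for j
    using that assms deg[OF that]
      lead_coeff_binomial_poly_mult[of "j - 1" "d - j" "real j - 2" "real (d - j)"]
    by simp
  hence *: "fact (d - 1) * coeff (join_clique_ehrhart p d) (d - 1) =
      real (\<Sum>j = 1..p. (d - 1) choose (j - 1))"
    by (simp add: join_clique_ehrhart_def coeff_sum sum_distrib_left)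
  have "(\<Sum>j = 1..p. (d - 1) choose (j - 1)) \<noteq> 0"
    using assms by (auto simp: sum_eq_0_iff intro!: bexI[of _ 1])
  hence "coeff (join_clique_ehrhart p d) (d - 1) \<noteq> 0"
    using * by (metis mult_zero_right of_nat_eq_0_iff)
  moreover have "degree (join_clique_ehrhart p d) \<le> d - 1"
    unfolding join_clique_ehrhart_def using deg by (intro degree_sum_le) auto
  ultimately show "degree (join_clique_ehrhart p d) = d - 1"
    by (intro antisym le_degree)
  with * show "fact (d - 1) * lead_coeff (join_clique_ehrhart p d) =
      real (\<Sum>j = 1..p. (d - 1) choose (j - 1))"
    by simp
qed

lemma is_ehrhart_polynomial_join_clique:
  fixes E :: "'n::finite set set"
  assumes edges: "\<forall>i\<in>L. \<forall>j. {i, j} \<in> E"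
    and cover: "\<forall>i j. {i, j} \<in> E \<longrightarrow> i \<in> L \<or> j \<in> L"
    and "L \<noteq> {}"
  shows "is_ehrhart_polynomial (edge_polytope E) (join_clique_ehrhart (card L) (CARD('n)))"
proof -
  obtain v where v: "v \<in> L" using assms(3) by blast
  have card: "1 \<le> card L" "card L \<le> CARD('n)"
    using assms(3) by (auto simp: Suc_le_eq card_gt_0_iff card_mono)
  have adj: "{i, v} \<in> E" for i
    using edges v insert_commute[of i v "{}"] by simp
  hence "aff_dim (edge_polytope E) = int (CARD('n) - card {v, v})"
    using adj[of v] by (intro aff_dim_edge_polytope[where r = "\<lambda>_. v"]) auto
  moreover have "real (card ((\<lambda>x. real m *\<^sub>R x) ` edge_polytope E \<inter> integer_lattice)) =
    poly (join_clique_ehrhart (card L) (CARD('n))) (real m)" if "m \<ge> 1" for m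
  proof -
    obtain n where n: "m = Suc n" using \<open>m \<ge> 1\<close> by (cases m) auto
    have "card ((\<lambda>x. real m *\<^sub>R x) ` edge_polytope E \<inter> integer_lattice) =
        card {f. sum f UNIV = Suc n + m \<and> Suc n \<le> sum f L}"
      using \<open>m \<ge> 1\<close>
      by (intro card_lattice_points_edge_polytope)
        (auto simp: edge_polytope_join_clique[OF edges cover] divide_eq_eq le_divide_eq n
          simp flip: sum_divide_distrib of_nat_sum)
    hence "real (card ((\<lambda>x. real m *\<^sub>R x) ` edge_polytope E \<inter> integer_lattice)) =
        (\<Sum>j = 1..card L. real ((j - 1 + n) choose (j - 1)) *
          real ((CARD('n) - j + m) choose (CARD('n) - j)))"
      by (simp only: card_large_block_sum of_nat_sum of_nat_mult)
    also have "\<dots> = poly (join_clique_ehrhart (card L) (CARD('n))) (real m)"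
      unfolding join_clique_ehrhart_def poly_sum poly_mult poly_binomial_poly
    proof (intro sum.cong refl arg_cong2[where f = "(*)"])
      fix j assume "j \<in> {1..card L}"
      thus "real ((j - 1 + n) choose (j - 1)) = (real j - 2 + real m) gchoose (j - 1)"
        by (simp add: binomial_gbinomial of_nat_diff n algebra_simps)
      show "real ((CARD('n) - j + m) choose (CARD('n) - j)) =
          (real (CARD('n) - j) + real m) gchoose (CARD('n) - j)"
        by (simp add: binomial_gbinomial)
    qed
    finally show ?thesis .
  qed
  ultimately show ?thesis
    by (simp add: is_ehrhart_polynomial_def degree_lead_coeff_join_clique_ehrhart[OF card])
qed

theorem theorem3p1:
  fixes E :: "'n::finite set set" and W :: "'n set"
  assumes "loop_graph E"
    and "no_isolated_vertex E"
    and "loops_adjacent E"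
    and "W = {i. \<not> has_loop E i}"
    and "W \<noteq> {}"
  shows
    "(\<forall>V\<^sub>1 V\<^sub>2 p q.
        complete_bipartite_on UNIV E V\<^sub>1 V\<^sub>2 \<and> has_4_cycle E \<and>
        card V\<^sub>1 = p \<and> card V\<^sub>2 = q \<longrightarrow>
        (\<forall>m::real. poly (ehrhart_polynomial (edge_polytope E)) m =
           ((real p + m - 1) gchoose (p - 1)) * ((real q + m - 1) gchoose (q - 1))) \<and>
        normalized_volume (edge_polytope E) = real ((p + q - 2) choose (p - 1))) \<and>
     (\<forall>v V\<^sub>1 V\<^sub>2 p q.
        {i. has_loop E i} = {v} \<and> (\<forall>j\<in>W. {v, j} \<in> E) \<and>
        complete_bipartite_on W (induced_edges E W) V\<^sub>1 V\<^sub>2 \<and>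
        card V\<^sub>1 = p \<and> card V\<^sub>2 = q \<longrightarrow>
        (\<forall>m::real. poly (ehrhart_polynomial (edge_polytope E)) m =
           ((real p + m) gchoose p) * ((real q + m) gchoose q)) \<and>
        normalized_volume (edge_polytope E) = real ((p + q) choose p)) \<and>
     (\<forall>p d.
        card {i. has_loop E i} = p \<and> p \<ge> 2 \<and> induced_edges E W = {} \<and>
        (\<forall>i j. has_loop E i \<and> j \<in> W \<longrightarrow> {i, j} \<in> E) \<and>
        CARD('n) = d \<longrightarrow>
        (\<forall>m::real. poly (ehrhart_polynomial (edge_polytope E)) m =
           (\<Sum>j = 1..p. ((real j + m - 2) gchoose (j - 1)) * ((real (d - j) + m) gchoose (d - j)))) \<and>
        normalized_volume (edge_polytope E) = real (\<Sum>j = 1..p. (d - 1) choose (j - 1)))"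
proof (intro conjI allI impI; elim conjE)
  fix V\<^sub>1 V\<^sub>2 p q
  assume bip: "complete_bipartite_on UNIV E V\<^sub>1 V\<^sub>2" and card: "card V\<^sub>1 = p" "card V\<^sub>2 = q"
  note ehr = is_ehrhart_polynomial_complete_bipartite[OF bip, unfolded card]
  have pos: "p > 0" "q > 0"
    using bip card by (auto simp: complete_bipartite_on_def card_gt_0_iff)
  show "poly (ehrhart_polynomial (edge_polytope E)) m =
      ((real p + m - 1) gchoose (p - 1)) * ((real q + m - 1) gchoose (q - 1))" for m
    by (simp add: ehrhart_polynomial_eqI[OF ehr] poly_binomial_poly algebra_simps)
  show "normalized_volume (edge_polytope E) = real ((p + q - 2) choose (p - 1))"
    using lead_coeff_binomial_poly_mult[of "p - 1" "q - 1"] pos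
    by (simp add: numeral_2_eq_2 normalized_volume_eq[OF ehr] degree_binomial_poly_mult)
next
  fix v V\<^sub>1 V\<^sub>2 p q
  assume v: "{i. has_loop E i} = {v}" "\<forall>j\<in>W. {v, j} \<in> E"
    and bip: "complete_bipartite_on W (induced_edges E W) V\<^sub>1 V\<^sub>2"
    and card: "card V\<^sub>1 = p" "card V\<^sub>2 = q"
  have W: "W = - {v}" using v(1) assms(4) by auto
  have V: "V\<^sub>1 \<inter> V\<^sub>2 = {}" "V\<^sub>1 \<union> V\<^sub>2 = W"
    and bip_edges: "induced_edges E W = {{i, j} | i j. i \<in> V\<^sub>1 \<and> j \<in> V\<^sub>2}"
    using bip by (auto simp: complete_bipartite_on_def)
  have "is_ehrhart_polynomial (edge_polytope E)
    (binomial_poly (real (card V\<^sub>1)) (card V\<^sub>1) * binomial_poly (real (card V\<^sub>2)) (card V\<^sub>2))"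
  proof (rule is_ehrhart_polynomial_cone_bipartite)
    show "v \<notin> V\<^sub>1" "v \<notin> V\<^sub>2" "V\<^sub>1 \<inter> V\<^sub>2 = {}" "insert v (V\<^sub>1 \<union> V\<^sub>2) = UNIV"
      using V W by auto
    have loop: "{v, v} \<in> E" using v(1) by (auto simp: has_loop_def)
    have "{i, j} \<in> E" if "i \<in> V\<^sub>1" "j \<in> V\<^sub>2" for i j
      using that bip_edges unfolding induced_edges_def by blast
    thus "\<forall>i\<in>insert v V\<^sub>1. \<forall>j\<in>insert v V\<^sub>2. {i, j} \<in> E"
      using loop v(2) V(2) by (auto simp: insert_commute)
    show "\<forall>i j. {i, j} \<in> E \<longrightarrow> \<not> {i, j} \<subseteq> V\<^sub>1 \<and> \<not> {i, j} \<subseteq> V\<^sub>2"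
    proof (intro allI impI, rule ccontr)
      fix i j assume ij: "{i, j} \<in> E" and "\<not> (\<not> {i, j} \<subseteq> V\<^sub>1 \<and> \<not> {i, j} \<subseteq> V\<^sub>2)"
      hence "{i, j} \<subseteq> V\<^sub>1 \<or> {i, j} \<subseteq> V\<^sub>2" by blast
      moreover from this have "{i, j} \<in> induced_edges E W"
        using ij V(2) by (auto simp: induced_edges_def)
      ultimately show False
        using V(1) unfolding bip_edges by (auto simp: doubleton_eq_iff)
    qed
  qed
  note ehr = this[unfolded card]
  show "poly (ehrhart_polynomial (edge_polytope E)) m =
      ((real p + m) gchoose p) * ((real q + m) gchoose q)" for m
    by (simp add: ehrhart_polynomial_eqI[OF ehr] poly_binomial_poly)
  show "normalized_volume (edge_polytope E) = real ((p + q) choose p)"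
    using lead_coeff_binomial_poly_mult[of p q]
    by (simp add: normalized_volume_eq[OF ehr] degree_binomial_poly_mult)
next
  fix p d
  assume card: "card {i. has_loop E i} = p" "CARD('n) = d" and p: "2 \<le> p"
    and indep: "induced_edges E W = {}"
    and join: "\<forall>i j. has_loop E i \<and> j \<in> W \<longrightarrow> {i, j} \<in> E"
  let ?L = "{i. has_loop E i}"
  have "is_ehrhart_polynomial (edge_polytope E) (join_clique_ehrhart (card ?L) (CARD('n)))"
  proof (rule is_ehrhart_polynomial_join_clique)
    show "\<forall>i\<in>?L. \<forall>j. {i, j} \<in> E"
      using join assms(3,4) unfolding loops_adjacent_def by blast
    show "\<forall>i j. {i, j} \<in> E \<longrightarrow> i \<in> ?L \<or> j \<in> ?L"
      using indep assms(4) by (auto simp: induced_edges_def)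
    show "?L \<noteq> {}" using card(1) p by (intro notI) simp
  qed
  note ehr = this[unfolded card]
  have "1 \<le> p" "p \<le> d"
    using p card card_mono[of UNIV ?L] by auto
  note lead = degree_lead_coeff_join_clique_ehrhart[OF this]
  show "poly (ehrhart_polynomial (edge_polytope E)) m =
      (\<Sum>j = 1..p. ((real j + m - 2) gchoose (j - 1)) * ((real (d - j) + m) gchoose (d - j)))" for m
    by (simp add: ehrhart_polynomial_eqI[OF ehr] join_clique_ehrhart_def poly_sum
        poly_binomial_poly algebra_simps)
  show "normalized_volume (edge_polytope E) = real (\<Sum>j = 1..p. (d - 1) choose (j - 1))"
    using lead by (simp add: normalized_volume_eq[OF ehr])
qed

end
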